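(* Let $0<r<R$. Consider the control system $\dot x=f(x,u)$ in the sample-and-hold mode under the optimization $\mathcal{AC}(x_k;R,r)$, with all objects as in the context. Let $q_1,q_2$ be the functions $q_1(s)=\underline l(s)\,\underline\theta$ and $q_2(s)=\overline\theta L_\varphi s$, and let $\bar\delta$ be the sampling-time bound described in the context for the radii $0<r^\ast<R^\ast$. Assume that there exists an admissible actor-critic sequence $(u_k,\theta_k)_{k\in\mathbb N_0}$ for $\mathcal{AC}(x_k;R,r)$ along sample-and-hold trajectories with a sampling period $0<\delta<\bar\delta$, and under some $\varepsilon_1,\varepsilon_2,\varepsilon_3\ge0$. Then there exist $0<\bar\delta_0\le\bar\delta$ and $\bar\varepsilon_1,\bar\varepsilon_3>0$ with the following property: if the sampling period $\delta>0$ satisfies $\delta\le\bar\delta_0$ and $\varepsilon_1\le\bar\varepsilon_1$, $\varepsilon_3\le\bar\varepsilon_3$, then the control action sequence $u_k$, $k\in\mathbb N_0$, of the actor-critic sequence $(u_k,\theta_k)_{k\in\mathbb N_0}$ practically stabilizes the origin of $\dot x=f(x,u)$.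
   Context: **Notation.** $\mathcal B_\rho$ is the closed ball of radius $\rho>0$ centered at the origin. A continuous function $\alpha:[0,a)\to[0,\infty)$ is of class $\mathcal K$ if it is strictly increasing with $\alpha(0)=0$, and of class $\mathcal K_\infty$ if in addition $a=\infty$ and $\alpha(s)\to\infty$ as $s\to\infty$. **System and sample-and-hold (SH) mode.** $f:\mathbb R^n\times\mathbb R^m\to\mathbb R^n$ is the dynamics model, $\mathbb U\subset\mathbb R^m$ is the input constraint set, and $f$ is locally Lipschitz in $x$ for any $u\in\mathbb U$. In SH-mode with sampling period $\delta>0$, $\dot x=f(x,u_k)$ for $t\in[k\delta,(k+1)\delta)$, $k\in\mathbb N_0$, with constant $u_k\in\mathbb U$ on each sampling interval and given $x(0)$; the resulting trajectory is called an SH-trajectory. Write $x_k:=x(k\delta)$, and let $x_{k+1}^{u}$ be the state at time $(k+1)\delta$ when the constant input $u$ is applied from $x_k$ on $[k\delta,(k+1)\delta)$. The predicted state is $\hat x_{k+1}^{u}:=x_k+\delta f(x_k,u)$. **Practical stabilization.** A control policy is said to practically (semi-globally) stabilize $\dot x=f(x,u)$ if, given $0<r<R<\infty$, there exists a sampling-time bound such that any SH-trajectory $x(t)$ with sampling time not exceeding that bound, starting in $\mathcal B_R$, is bounded, enters $\mathcal B_r$ after a time $T$ which depends uniformly on $R,r$, and remains there for all $t\ge T$. The same terminology is used for a control action sequence applied in SH-mode; $\mathcal B_R$ is the starting ball and $\mathcal B_r$ the target ball. **Control Lyapunov function (Assumption A).** For locally Lipschitz $V:\mathbb R^n\to\mathbb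 R$ and $v\in\mathbb R^n$ let $\mathcal D_vV(x):=\liminf_{\tau\to0_+}\frac1\tau\left(V(x+\tau v)-V(x)\right)$. There exist a locally Lipschitz, positive-definite $V:\mathbb R^n\to\mathbb R_{\ge0}$, a continuous positive-definite $w:\mathbb R^n\to\mathbb R_{\ge0}$ and $\alpha_1,\alpha_2\in\mathcal K_\infty$ such that for any compact $\mathbb X\subset\mathbb R^n$ there exists a compact set $\mathbb U_{\mathbb X}\subseteq\mathbb U$ such that, for any $x\in\mathbb X$, $\inf_{u\in\mathbb U_{\mathbb X}}\mathcal D_{f(x,u)}V(x)\le-w(x)$ and $\alpha_1(\|x\|)\le V(x)\le\alpha_2(\|x\|)$. **Critic.** $\hat J:\mathbb R^n\times\mathbb R^p\to\mathbb R_{\ge0}$, $\hat J(x,\theta):=\langle\theta,\varphi(x)\rangle$, with weights $\theta\in\mathbb R^p$ and a locally Lipschitz activation function $\varphi:\mathbb R^n\to\mathbb R^p$. On any compact $\mathbb X\subset\mathbb R^n$, $\hat J(x,\theta)\le\|\theta\|L_\varphi\|x\|$, with $L_\varphi$ the corresponding Lipschitz constant of $\varphi$ on $\mathbb X$. The activation function satisfies: there exists $\underline l\in\mathcal K$ such that for any $x\in\mathbb R^n$ and $\theta\in\mathbb R^p$, $\langle\theta,\varphi(x)\rangle\ge\underline l(\|x\|)\cdot\|\theta\|$. (Assumption B) There exists $\theta^{\#}\in\mathbb R^p$ such that $V(x)=\hat J(x,\theta^{\#})$ for all $x\in\mathbb R^n$. **Constants.** Let $\underline\theta,\overline\theta$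 be such that $\underline\theta\le\|\theta^{\#}\|\le\overline\theta$, and set $\Theta:=\{\theta\in\mathbb R^p:\underline\theta\le\|\theta\|\le\overline\theta\}$ and $q_1(s):=\underline l(s)\,\underline\theta$. Given $0<r<R$, let $\bar J:=\sup_{x\in\mathcal B_R,\theta\in\Theta}\hat J(x,\theta)$; fix $\eta_R>0$ and $R^\ast>R$ with $q_1(R^\ast)\ge\bar J+\eta_R$; let $L_\varphi>0$ be the Lipschitz constant of $\varphi$ on $\mathcal B_{R^\ast}$ and $q_2(s):=\overline\theta L_\varphi s$. Here $q_1,q_2\in\mathcal K_\infty$. Let $v^\ast:=q_1(r)$ and $r^\ast:=q_2^{-1}(v^\ast/2)$, so that $r^\ast\le r$; $\mathcal B_{r^\ast}$ is called the core ball. The bound $\bar\delta>0$ (which exists under Assumption A) is such that for any $0<\delta\le\bar\delta$ there is a (possibly discontinuous) map $\mu:\mathbb R^n\to\mathbb U$ with $V\big(x_{k+1}^{\mu(x_k)}\big)-V(x_k)\le-\frac\delta2w(x_k)$ on $\mathcal B_{R^\ast}\setminus\mathcal B_{r^\ast}$. **Actor-critic problem $\mathcal{AC}(x_k;R,r)$.** With $x(0)\in\mathcal B_R$ and relaxation terms $\varepsilon_1,\varepsilon_2,\varepsilon_3\ge0$, at the state $x_k$, $k\in\mathbb N_0$, minimize over $(u,\theta)\in\mathbb U\times\Theta$ the squared Bellman error $\big(\rho(x_k,u)+\hat J(\hat x_{k+1}^u,\theta_{k-1})-\hat J(x_k,\theta)\big)^2$, where $\rho:\mathbb R^n\times\mathbb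 R^m\to\mathbb R_{\ge0}$ is a given reward function and $\theta_{k-1}$ is the weight from the preceding step (nothing further is specified about the initializing weight $\theta_{-1}$), subject to (C1) $\hat J(x_k,\theta)\le\hat J(x_k,\theta_{k-1})+\varepsilon_1$; (C2) $V(\hat x_{k+1}^u)\le\hat J(\hat x_{k+1}^u,\theta)+\varepsilon_2$; (C3) $\hat J(\hat x_{k+1}^u,\theta)-\hat J(x_k,\theta)\le-\frac\delta2w(x_k)+\varepsilon_3$; (C4) $q_1(\|x_k\|)\le\hat J(x_k,\theta)\le q_2(\|x_k\|)$. Once $x_k\in\mathcal B_{r^\ast}$, the setting of $(u_k,\theta_k)$ is arbitrary. A sequence $(u_k,\theta_k)_{k\in\mathbb N_0}$ is *admissible* if, for any $k\in\mathbb N_0$, (C1)–(C4) are satisfied with $(u,\theta)=(u_k,\theta_k)$ along the SH-trajectory as long as $x_k\notin\mathcal B_{r^\ast}$.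
   Formalization: Critic bounds are assumed only for weights in a set W containing θ#, with Θ restricted to W (for all θ they are contradictory); ε̄1, ε̄3 may depend on δ; f is jointly continuous on R^n×U and the actions lie in a compact K⊆U, the bounds depending on K (otherwise the claim fails). *)

theory Defs
  imports "HOL-Analysis.Analysis"
begin

definition class_K :: "ereal \<Rightarrow> (real \<Rightarrow> real) \<Rightarrow> bool" where
  "class_K a \<alpha> \<longleftrightarrow>
     (let I = {s. 0 \<le> s \<and> ereal s < a} in
       continuous_on I \<alpha> \<and> strict_mono_on I \<alpha> \<and> \<alpha> 0 = 0 \<and> (\<forall>s\<in>I. 0 \<le> \<alpha> s))"

definition class_K_inf :: "(real \<Rightarrow> real) \<Rightarrow> bool" where
  "class_K_inf \<alpha> \<longleftrightarrow> class_K \<infinity> \<alpha> \<and> filterlim \<alpha> at_top at_top"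

definition locally_lipschitz :: "('a::metric_space \<Rightarrow> 'b::metric_space) \<Rightarrow> bool" where
  "locally_lipschitz g \<longleftrightarrow> (\<forall>x. \<exists>e>0. \<exists>L. L-lipschitz_on (cball x e) g)"

definition positive_definite :: "('a::zero \<Rightarrow> real) \<Rightarrow> bool" where
  "positive_definite g \<longleftrightarrow> g 0 = 0 \<and> (\<forall>x. x \<noteq> 0 \<longrightarrow> 0 < g x)"

(* Lower directional derivative.  It is taken in ereal, where the lower limit always exists;
   for locally Lipschitz V it is finite. *)
definition lower_dir_deriv :: "('a::real_normed_vector \<Rightarrow> real) \<Rightarrow> 'a \<Rightarrow> 'a \<Rightarrow> ereal" where
  "lower_dir_deriv V v x = Liminf (at_right 0) (\<lambda>\<tau>. ereal ((V (x + \<tau> *\<^sub>R v) - V x) / \<tau>))"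

(* The infimum over an empty set of actions is \<infinity>, so UX is forced to be nonempty whenever X is. *)
definition control_lyapunov ::
  "('a::real_normed_vector \<Rightarrow> 'b::topological_space \<Rightarrow> 'a) \<Rightarrow> 'b set \<Rightarrow> ('a \<Rightarrow> real) \<Rightarrow>
   ('a \<Rightarrow> real) \<Rightarrow> (real \<Rightarrow> real) \<Rightarrow> (real \<Rightarrow> real) \<Rightarrow> bool" where
  "control_lyapunov f U V w \<alpha>1 \<alpha>2 \<longleftrightarrow>
     locally_lipschitz V \<and> positive_definite V \<and>
     continuous_on UNIV w \<and> positive_definite w \<and>
     class_K_inf \<alpha>1 \<and> class_K_inf \<alpha>2 \<and>
     (\<forall>X. compact X \<longrightarrow>
        (\<exists>UX. compact UX \<and> UX \<subseteq> U \<and>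
           (\<forall>x\<in>X. (INF u\<in>UX. lower_dir_deriv V (f x u) x) \<le> ereal (- w x) \<and>
                  \<alpha>1 (norm x) \<le> V x \<and> V x \<le> \<alpha>2 (norm x))))"

definition sh_trajectory ::
  "('a::real_normed_vector \<Rightarrow> 'b \<Rightarrow> 'a) \<Rightarrow> 'b set \<Rightarrow> real \<Rightarrow> (nat \<Rightarrow> 'b) \<Rightarrow> (real \<Rightarrow> 'a) \<Rightarrow> bool" where
  "sh_trajectory f U \<delta> u x \<longleftrightarrow>
     (\<forall>k. u k \<in> U) \<and> continuous_on {0..} x \<and>
     (\<forall>k. \<forall>t\<in>{real k * \<delta> ..< real (Suc k) * \<delta>}.
        (x has_vector_derivative f (x t) (u k))
          (at t within {real k * \<delta> ..< real (Suc k) * \<delta>}))"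

(* y is the state reached from x after holding the action u for the time \<delta>.  The system is
   autonomous, so the starting time is taken to be 0. *)
definition sh_step ::
  "('a::real_normed_vector \<Rightarrow> 'b \<Rightarrow> 'a) \<Rightarrow> real \<Rightarrow> 'b \<Rightarrow> 'a \<Rightarrow> 'a \<Rightarrow> bool" where
  "sh_step f \<delta> u x y \<longleftrightarrow>
     (\<exists>z. z 0 = x \<and> z \<delta> = y \<and> continuous_on {0..\<delta>} z \<and>
        (\<forall>t\<in>{0..<\<delta>}. (z has_vector_derivative f (z t) u) (at t within {0..<\<delta>})))"

definition predicted_state ::
  "('a::real_normed_vector \<Rightarrow> 'b \<Rightarrow> 'a) \<Rightarrow> real \<Rightarrow> 'b \<Rightarrow> 'a \<Rightarrow> 'a" where
  "predicted_state f \<delta> u x = x + \<delta> *\<^sub>R f x u"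

(* A control scheme is represented by the sets X \<delta> of the SH-trajectories that it generates with
   sampling period \<delta>.  The time T is uniform over all of them and over all \<delta> up to \<delta>b. *)
definition practically_stabilizes ::
  "real \<Rightarrow> real \<Rightarrow> real \<Rightarrow> (real \<Rightarrow> (real \<Rightarrow> 'a::real_normed_vector) set) \<Rightarrow> bool" where
  "practically_stabilizes R r \<delta>b X \<longleftrightarrow>
     (\<exists>T\<ge>0. \<forall>\<delta>. 0 < \<delta> \<and> \<delta> \<le> \<delta>b \<longrightarrow>
        (\<forall>x\<in>X \<delta>. x 0 \<in> cball 0 R \<longrightarrow>
           bounded (x ` {0..}) \<and> (\<forall>t\<ge>T. x t \<in> cball 0 r)))"

definition critic :: "('a \<Rightarrow> 'c::real_inner) \<Rightarrow> 'a \<Rightarrow> 'c \<Rightarrow> real" where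
  "critic \<phi> x \<theta> = \<theta> \<bullet> \<phi> x"

(* L is a Lipschitz constant of the activation function on X for which the linear upper bound on
   the critic holds.  A set such as {x} with x \<noteq> 0 has the Lipschitz constant 0, for which
   that bound fails, so the bound cannot be asked of every Lipschitz constant on every X. *)
definition critic_constant ::
  "('a::real_normed_vector \<Rightarrow> 'c::real_inner) \<Rightarrow> 'c set \<Rightarrow> 'a set \<Rightarrow> real \<Rightarrow> bool" where
  "critic_constant \<phi> W X L \<longleftrightarrow>
     L-lipschitz_on X \<phi> \<and> (\<forall>x\<in>X. \<forall>\<theta>\<in>W. critic \<phi> x \<theta> \<le> norm \<theta> * L * norm x)"

(* W is the set of weights for which the critic is bounded below by a class K function.  Such a
   bound cannot hold for both \<theta> and -\<theta>, hence not on the whole space. *)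
definition weight_set :: "'c::real_normed_vector set \<Rightarrow> real \<Rightarrow> real \<Rightarrow> 'c set" where
  "weight_set W \<theta>lo \<theta>hi = {\<theta>\<in>W. \<theta>lo \<le> norm \<theta> \<and> norm \<theta> \<le> \<theta>hi}"

definition critic_sup ::
  "('a::real_normed_vector \<Rightarrow> 'c::real_inner) \<Rightarrow> real \<Rightarrow> 'c set \<Rightarrow> real" where
  "critic_sup \<phi> R \<Theta> = (SUP (x, \<theta>)\<in>cball 0 R \<times> \<Theta>. critic \<phi> x \<theta>)"

definition sampling_bound ::
  "('a::real_normed_vector \<Rightarrow> 'b \<Rightarrow> 'a) \<Rightarrow> 'b set \<Rightarrow> ('a \<Rightarrow> real) \<Rightarrow> ('a \<Rightarrow> real) \<Rightarrow>
   real \<Rightarrow> real \<Rightarrow> real \<Rightarrow> bool" where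
  "sampling_bound f U V w rs Rs \<delta>b \<longleftrightarrow>
     0 < \<delta>b \<and>
     (\<forall>\<delta>. 0 < \<delta> \<and> \<delta> \<le> \<delta>b \<longrightarrow>
        (\<exists>\<mu>. range \<mu> \<subseteq> U \<and>
           (\<forall>x\<in>cball 0 Rs - cball 0 rs.
              \<exists>y. sh_step f \<delta> (\<mu> x) x y \<and> V y - V x \<le> - (\<delta> / 2) * w x)))"

(* The constraints (C1)-(C4) at the state x, with preceding weight \<theta>p. *)
definition ac_feasible ::
  "('a::real_normed_vector \<Rightarrow> 'b \<Rightarrow> 'a) \<Rightarrow> 'b set \<Rightarrow> ('a \<Rightarrow> 'c::real_inner) \<Rightarrow> 'c set \<Rightarrow>
   ('a \<Rightarrow> real) \<Rightarrow> ('a \<Rightarrow> real) \<Rightarrow> (real \<Rightarrow> real) \<Rightarrow> (real \<Rightarrow> real) \<Rightarrow>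
   real \<Rightarrow> real \<Rightarrow> real \<Rightarrow> real \<Rightarrow> 'a \<Rightarrow> 'c \<Rightarrow> 'b \<Rightarrow> 'c \<Rightarrow> bool" where
  "ac_feasible f U \<phi> \<Theta> V w q1 q2 \<delta> \<epsilon>1 \<epsilon>2 \<epsilon>3 x \<theta>p u \<theta> \<longleftrightarrow>
     u \<in> U \<and> \<theta> \<in> \<Theta> \<and>
     critic \<phi> x \<theta> \<le> critic \<phi> x \<theta>p + \<epsilon>1 \<and>
     V (predicted_state f \<delta> u x) \<le> critic \<phi> (predicted_state f \<delta> u x) \<theta> + \<epsilon>2 \<and>
     critic \<phi> (predicted_state f \<delta> u x) \<theta> - critic \<phi> x \<theta> \<le> - (\<delta> / 2) * w x + \<epsilon>3 \<and>
     q1 (norm x) \<le> critic \<phi> x \<theta> \<and> critic \<phi> x \<theta> \<le> q2 (norm x)"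

(* Admissibility is feasibility outside the core ball of radius rs along the sampled trajectory;
   optimality for the Bellman error is not required, so minimizers are a special case.
   \<theta>i is the initializing weight, of which nothing is assumed. *)
definition ac_admissible ::
  "('a::real_normed_vector \<Rightarrow> 'b \<Rightarrow> 'a) \<Rightarrow> 'b set \<Rightarrow> ('a \<Rightarrow> 'c::real_inner) \<Rightarrow> 'c set \<Rightarrow>
   ('a \<Rightarrow> real) \<Rightarrow> ('a \<Rightarrow> real) \<Rightarrow> (real \<Rightarrow> real) \<Rightarrow> (real \<Rightarrow> real) \<Rightarrow> real \<Rightarrow>
   real \<Rightarrow> real \<Rightarrow> real \<Rightarrow> real \<Rightarrow> (real \<Rightarrow> 'a) \<Rightarrow> 'c \<Rightarrow> (nat \<Rightarrow> 'b) \<Rightarrow> (nat \<Rightarrow> 'c) \<Rightarrow> bool" where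
  "ac_admissible f U \<phi> \<Theta> V w q1 q2 rs \<delta> \<epsilon>1 \<epsilon>2 \<epsilon>3 x \<theta>i u \<theta> \<longleftrightarrow>
     (\<forall>k. x (real k * \<delta>) \<notin> cball 0 rs \<longrightarrow>
        ac_feasible f U \<phi> \<Theta> V w q1 q2 \<delta> \<epsilon>1 \<epsilon>2 \<epsilon>3 (x (real k * \<delta>))
          (case k of 0 \<Rightarrow> \<theta>i | Suc j \<Rightarrow> \<theta> j) (u k) (\<theta> k))"

end

theory Submission
  imports Defs
begin

text \<open>
  Outside the core ball the number \<open>J\<^sub>k = critic \<phi> x\<^sub>k \<theta>\<^sub>k\<close> serves as a Lyapunov function of the
  sampled trajectory, although the weights change from step to step.  Constraint (C3) decreases the
  critic by \<open>\<delta> w(x\<^sub>k) / 2 - \<epsilon>3\<close> up to the predicted state, and (C1) lets the weights be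
  exchanged at the price of \<open>\<epsilon>1\<close>.  Between the two lies the passage from the predicted to the
  true next state.  Since the actions stay in a compact set, \<open>f\<close> is bounded by some \<open>M\<close> and
  uniformly continuous where it matters, so the prediction error is \<open>o(\<delta>)\<close> uniformly in the state
  and the action (lemmas \<open>held_displacement\<close>, \<open>held_prediction_error\<close>).  As \<open>w\<close> is bounded
  below by some \<open>8 c > 0\<close> on the compact shell between the radii \<open>rs\<close> and \<open>Rs\<close>, a small \<open>\<delta>\<close> and bounds \<open>\<epsilon>1, \<epsilon>3 \<le> c \<delta>\<close> leave
  a net decrease of \<open>c \<delta>\<close> in each step.  This is why the bounds on the relaxation terms are
  proportional to the sampling period.

  The lower bound in (C4) turns a bound on \<open>J\<^sub>k\<close> into a bound on the state: the initial value of
  \<open>J\<^sub>k\<close> is at most \<open>critic_sup \<phi> R \<Theta>\<close>, which keeps the samples strictly inside the ball of radius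
  \<open>Rs\<close>, and the constant decrease forces a visit to the core ball within one
  sampling period of the time (initial level)\<open> / c\<close>, which depends neither on \<open>\<delta>\<close> nor on the trajectory.

  Inside the core ball nothing is known about the weights, so (C1) says nothing about the first
  step after leaving it.  There the upper bound in (C4) takes over: the state is still within
  \<open>rs + M \<delta>\<close> of the origin, so \<open>J\<^sub>k\<close> restarts from at most
  \<open>q2 rs + O(\<delta>) = q1 r / 2 + O(\<delta>)\<close>, which is below \<open>q1 r\<close>.  From then on it cannot rise above
  that level, which keeps the samples, and for small \<open>\<delta>\<close> the whole trajectory, in the target
  ball.  Lemma \<open>descent_with_restarts\<close> is this bookkeeping for real sequences.
\<close>

section \<open>Sampled motion under a held action\<close>

text \<open>
  The vector field needs to be bounded only near the starting point: a motion of speed at most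
  \<open>M\<close> cannot reach distance \<open>d\<close> before the time \<open>d / M\<close>.  So the curve need not be known in advance
  to stay in the region where the bound holds.
\<close>

lemma held_displacement:
  fixes x :: "real \<Rightarrow> 'a::euclidean_space"
  assumes cont: "continuous_on {a..b} x"
    and der: "\<And>t. t \<in> {a..<b} \<Longrightarrow> (x has_vector_derivative g (x t)) (at t within {a..<b})"
    and bnd: "\<And>y. y \<in> cball (x a) d \<Longrightarrow> norm (g y) \<le> M"
    and d: "0 \<le> M" "M * (b - a) < d"
    and t: "t \<in> {a..b}"
  shows "norm (x t - x a) \<le> M * (t - a)"
proof -
  have mvt: "norm (x s - x a) \<le> M * (s - a)"
    if s: "s \<in> {a..b}" and near: "\<And>\<tau>. \<tau> \<in> {a<..<s} \<Longrightarrow> norm (x \<tau> - x a) < d" for s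
  proof (cases "a < s")
    case True
    have "continuous_on {a..s} x"
      using cont s by (auto intro: continuous_on_subset)
    moreover have "(x has_derivative (\<lambda>h. h *\<^sub>R g (x \<tau>))) (at \<tau>)" if "a < \<tau>" "\<tau> < s" for \<tau>
    proof -
      have "(x has_vector_derivative g (x \<tau>)) (at \<tau> within {a<..<b})"
        using der[of \<tau>] that s by (auto intro: has_vector_derivative_within_subset)
      then show ?thesis
        using that s by (simp add: at_within_open[of \<tau> "{a<..<b}"] has_vector_derivative_def)
    qed
    ultimately obtain \<tau> where \<tau>: "\<tau> \<in> {a<..<s}" "norm (x s - x a) \<le> norm ((s - a) *\<^sub>R g (x \<tau>))"
      using mvt_general[OF True, of x "\<lambda>\<tau> h. h *\<^sub>R g (x \<tau>)"] by auto
    have "norm (g (x \<tau>)) \<le> M"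
      using near[OF \<tau>(1)] by (intro bnd) (simp add: dist_norm norm_minus_commute)
    then have "norm ((s - a) *\<^sub>R g (x \<tau>)) \<le> M * (s - a)"
      using True by (simp add: mult.commute mult_left_mono)
    then show ?thesis using \<tau>(2) by linarith
  next
    case False
    then show ?thesis using s by simp
  qed
  define S where "S = {s \<in> {a..b}. d \<le> norm (x s - x a)}"
  have "S = {}"
  proof (rule ccontr)
    assume "S \<noteq> {}"
    moreover have "compact S"
    proof -
      have "closed ({a..b} \<inter> (\<lambda>s. norm (x s - x a)) -` {d..})"
        using cont by (intro continuous_closed_preimage continuous_intros) auto
      then have "closed S"
        by (simp add: S_def vimage_def Int_def)
      moreover have "S \<subseteq> {a..b}" by (auto simp: S_def)
      ultimately show ?thesis
        using compact_Icc compact_Int_closed[of "{a..b}" S] by (simp add: Int_absorb1)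
    qed
    \<comment> \<open>the first time at which the distance \<open>d\<close> is reached\<close>
    ultimately obtain s where s: "s \<in> S" "\<And>\<tau>. \<tau> \<in> S \<Longrightarrow> s \<le> \<tau>"
      using compact_attains_inf[of S] by auto
    have "norm (x \<tau> - x a) < d" if "\<tau> \<in> {a<..<s}" for \<tau>
      using s(1) s(2)[of \<tau>] that by (cases "d \<le> norm (x \<tau> - x a)") (auto simp: S_def)
    then have "norm (x s - x a) \<le> M * (s - a)"
      using s(1) by (intro mvt) (auto simp: S_def)
    also have "\<dots> \<le> M * (b - a)"
      using s(1) d(1) by (intro mult_left_mono) (auto simp: S_def)
    finally show False using d(2) s(1) by (simp add: S_def)
  qed
  then have "norm (x \<tau> - x a) < d" if "\<tau> \<in> {a..b}" for \<tau>
    using that unfolding S_def by fastforce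
  then show ?thesis using t by (intro mvt) auto
qed

text \<open>
  The deviation from the explicit Euler step is itself a motion, with velocity
  \<open>g (x t) - g (x a)\<close>, whose norm is bounded by the oscillation \<open>e\<close> of \<open>g\<close> near the starting point.
\<close>

lemma held_prediction_error:
  fixes x :: "real \<Rightarrow> 'a::euclidean_space"
  assumes "a < b"
    and cont: "continuous_on {a..b} x"
    and der: "\<And>t. t \<in> {a..<b} \<Longrightarrow> (x has_vector_derivative g (x t)) (at t within {a..<b})"
    and bnd: "\<And>y. y \<in> cball (x a) d \<Longrightarrow> norm (g y) \<le> M"
    and d: "0 \<le> M" "M * (b - a) < d"
    and osc: "\<And>y. y \<in> cball (x a) d \<Longrightarrow> norm (g y - g (x a)) \<le> e"
  shows "norm (x b - (x a + (b - a) *\<^sub>R g (x a))) \<le> e * (b - a)"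
proof -
  let ?z = "\<lambda>t. x t - t *\<^sub>R g (x a)"
  have "continuous_on {a..b} ?z"
    using cont by (intro continuous_intros)
  moreover have "(?z has_derivative (\<lambda>h. h *\<^sub>R (g (x \<tau>) - g (x a)))) (at \<tau>)" if "a < \<tau>" "\<tau> < b" for \<tau>
  proof -
    have "(x has_vector_derivative g (x \<tau>)) (at \<tau> within {a<..<b})"
      using der[of \<tau>] that by (auto intro: has_vector_derivative_within_subset)
    then have "(x has_derivative (\<lambda>h. h *\<^sub>R g (x \<tau>))) (at \<tau>)"
      using that by (simp add: at_within_open[of \<tau> "{a<..<b}"] has_vector_derivative_def)
    then show ?thesis
      by (auto intro!: derivative_eq_intros simp: scaleR_diff_right)
  qed
  ultimately obtain \<tau> where \<tau>: "\<tau> \<in> {a<..<b}"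
      "norm (?z b - ?z a) \<le> norm ((b - a) *\<^sub>R (g (x \<tau>) - g (x a)))"
    using mvt_general[OF \<open>a < b\<close>, of ?z "\<lambda>\<tau> h. h *\<^sub>R (g (x \<tau>) - g (x a))"] by auto
  have "norm (x \<tau> - x a) \<le> M * (\<tau> - a)"
    using \<tau>(1) by (intro held_displacement[OF cont der bnd d]) auto
  also have "\<dots> \<le> M * (b - a)"
    using \<tau>(1) d(1) by (intro mult_left_mono) auto
  finally have "norm (g (x \<tau>) - g (x a)) \<le> e"
    using d(2) by (intro osc) (simp add: dist_norm norm_minus_commute)
  then have "norm ((b - a) *\<^sub>R (g (x \<tau>) - g (x a))) \<le> e * (b - a)"
    using \<open>a < b\<close> by (simp add: mult.commute mult_left_mono)
  moreover have "?z b - ?z a = x b - (x a + (b - a) *\<^sub>R g (x a))"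
    by (simp add: algebra_simps)
  ultimately show ?thesis using \<tau>(2) by (simp only: order_trans)
qed

lemma compact_product_bound_and_modulus:
  fixes f :: "'a::euclidean_space \<Rightarrow> 'b::euclidean_space \<Rightarrow> 'c::real_normed_vector"
  assumes "compact B" "compact K" and cont: "continuous_on (B \<times> K) (\<lambda>(x, u). f x u)" and "0 < e"
  obtains M h where "0 < M" "\<And>x u. x \<in> B \<Longrightarrow> u \<in> K \<Longrightarrow> norm (f x u) \<le> M"
    and "0 < h" "\<And>x y u. x \<in> B \<Longrightarrow> y \<in> B \<Longrightarrow> u \<in> K \<Longrightarrow> dist x y < h \<Longrightarrow> norm (f y u - f x u) \<le> e"
proof -
  have com: "compact (B \<times> K)"
    using assms by (intro compact_Times)
  then have "bounded ((\<lambda>(x, u). f x u) ` (B \<times> K))"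
    using cont compact_continuous_image compact_imp_bounded by blast
  then obtain M where M: "0 < M" "\<And>x u. x \<in> B \<Longrightarrow> u \<in> K \<Longrightarrow> norm (f x u) \<le> M"
    unfolding bounded_pos by fastforce
  have "uniformly_continuous_on (B \<times> K) (\<lambda>(x, u). f x u)"
    using com cont by (rule compact_uniformly_continuous[rotated])
  then obtain h where h: "0 < h"
      "\<And>p q. p \<in> B \<times> K \<Longrightarrow> q \<in> B \<times> K \<Longrightarrow> dist q p < h
         \<Longrightarrow> dist ((\<lambda>(x, u). f x u) q) ((\<lambda>(x, u). f x u) p) < e"
    using \<open>0 < e\<close> unfolding uniformly_continuous_on_def by metis
  have "norm (f y u - f x u) \<le> e" if "x \<in> B" "y \<in> B" "u \<in> K" "dist x y < h" for x y u
    using h(2)[of "(x, u)" "(y, u)"] that by (simp add: dist_norm norm_minus_commute dist_Pair_Pair)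
  with M h(1) show thesis using that by blast
qed

lemma sampling_interval:
  fixes t \<delta> :: real
  assumes "0 < \<delta>" "0 \<le> t"
  obtains k :: nat where "t \<in> {real k * \<delta>..real (Suc k) * \<delta>}" "t < real (Suc k) * \<delta>"
proof -
  let ?k = "nat \<lfloor>t / \<delta>\<rfloor>"
  have "real ?k \<le> t / \<delta>" "t / \<delta> < real (Suc ?k)"
    using assms by (simp_all) linarith+
  then have "real ?k * \<delta> \<le> t" "t < real (Suc ?k) * \<delta>"
    using assms by (simp_all only: pos_le_divide_eq pos_divide_less_eq)
  then show thesis by (intro that[of ?k]) auto
qed

section \<open>Comparison functions and the critic\<close>

lemma class_K_infD:
  assumes "class_K_inf q"
  shows "continuous_on {0..} q" "strict_mono_on {0..} q" "q 0 = 0"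
proof -
  have "{s. 0 \<le> s \<and> ereal s < \<infinity>} = {0..}" by auto
  then show "continuous_on {0..} q" "strict_mono_on {0..} q" "q 0 = 0"
    using assms by (simp_all add: class_K_inf_def class_K_def Let_def)
qed

lemma class_K_inf_radius:
  assumes q: "class_K_inf q" and "0 \<le> a" "a \<le> b" "q a \<le> y" "y < q b"
  obtains s where "a \<le> s" "s < b" "q s = y"
proof -
  have "continuous_on {a..b} q"
    by (rule continuous_on_subset[OF class_K_infD(1)[OF q]]) (use assms in auto)
  then obtain s where "a \<le> s" "s \<le> b" "q s = y"
    using IVT'[of q a y b] assms by auto
  then show thesis using that[of s] assms by (cases "s = b") auto
qed

lemma class_K_inf_le_iff:
  assumes "class_K_inf q" "0 \<le> a" "0 \<le> b"
  shows "q a \<le> q b \<longleftrightarrow> a \<le> b"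
  using strict_mono_on_less_eq[OF class_K_infD(2)[OF assms(1)], of a b] assms by simp

lemma critic_diff_le:
  assumes "critic_constant \<phi> W X L" "x \<in> X" "y \<in> X" "norm \<theta> \<le> h" "0 \<le> L"
  shows "critic \<phi> y \<theta> - critic \<phi> x \<theta> \<le> h * L * norm (y - x)"
proof -
  have "norm (\<phi> y - \<phi> x) \<le> L * norm (y - x)"
    using assms by (auto simp: critic_constant_def dist_norm dest: lipschitz_onD)
  then have "norm \<theta> * norm (\<phi> y - \<phi> x) \<le> h * (L * norm (y - x))"
    using assms by (intro mult_mono order_trans[OF norm_ge_zero assms(4)]) auto
  moreover have "critic \<phi> y \<theta> - critic \<phi> x \<theta> \<le> norm \<theta> * norm (\<phi> y - \<phi> x)"
    using norm_cauchy_schwarz[of \<theta> "\<phi> y - \<phi> x"] by (simp add: critic_def inner_diff_right)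
  ultimately show ?thesis by (simp add: mult.assoc)
qed

text \<open>
  The linear bound makes the supremum finite, so that it is an upper bound of the critic.
\<close>

lemma critic_le_critic_sup:
  assumes "critic_constant \<phi> W X L" "0 \<le> L" "cball 0 R \<subseteq> X"
    and "x \<in> cball 0 R" "\<theta> \<in> weight_set W lo hi"
  shows "critic \<phi> x \<theta> \<le> critic_sup \<phi> R (weight_set W lo hi)"
proof -
  have "critic \<phi> y \<zeta> \<le> hi * L * R" if "y \<in> cball 0 R" "\<zeta> \<in> weight_set W lo hi" for y \<zeta>
  proof -
    have "critic \<phi> y \<zeta> \<le> norm \<zeta> * L * norm y"
      using assms that by (auto simp: critic_constant_def weight_set_def)
    also have "\<dots> \<le> hi * L * R"
      using assms that by (intro mult_mono mult_nonneg_nonneg)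
        (auto simp: weight_set_def intro: order_trans[OF norm_ge_zero])
    finally show ?thesis .
  qed
  then have "bdd_above ((\<lambda>(x, \<theta>). critic \<phi> x \<theta>) ` (cball 0 R \<times> weight_set W lo hi))"
    by (intro bdd_aboveI[of _ "hi * L * R"]) auto
  from cSUP_upper[OF _ this, of "(x, \<theta>)"] show ?thesis
    using assms by (simp add: critic_sup_def)
qed

section \<open>Descent with restarts\<close>

text \<open>
  A sequence descends by \<open>a\<close> at each step except at the indices marked by \<open>core\<close>, after which it
  restarts from the level \<open>v\<close>.  At every other index it is either below \<open>v\<close>, owing to an earlier
  restart, or has been descending from the beginning; for nonnegative
  \<open>J\<close> and \<open>a > 0\<close> the latter cannot last longer than \<open>C / a\<close> steps.
\<close>

lemma descent_with_restarts:
  fixes J :: "nat \<Rightarrow> real"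
  assumes a: "0 \<le> a" and "v \<le> C"
    and start: "\<not> core 0 \<Longrightarrow> J 0 \<le> C"
    and step: "\<And>k. \<not> core k \<Longrightarrow> J k \<le> C \<Longrightarrow> \<not> core (Suc k) \<Longrightarrow> J (Suc k) \<le> J k - a"
    and restart: "\<And>k. core k \<Longrightarrow> \<not> core (Suc k) \<Longrightarrow> J (Suc k) \<le> v"
  shows "core k \<or> J k \<le> v \<or> J k \<le> C - real k * a"
proof (induction k)
  case 0
  then show ?case using start by auto
next
  case (Suc k)
  have "0 \<le> real k * a" using a by simp
  with Suc \<open>v \<le> C\<close> have "core k \<or> J k \<le> C" by linarith
  then consider "core k \<or> core (Suc k)" | "J (Suc k) \<le> J k - a" "\<not> core k"
    using step by blast
  then show ?case
  proof cases
    case 1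
    then show ?thesis using restart by blast
  next
    case 2
    with Suc a show ?thesis by (auto simp: algebra_simps)
  qed
qed

section \<open>Practical stabilization\<close>

theorem theorem1:
  fixes f :: "real ^ 'n \<Rightarrow> real ^ 'm \<Rightarrow> real ^ 'n"
    and U :: "(real ^ 'm) set"
    and V w :: "real ^ 'n \<Rightarrow> real"
    and \<phi> :: "real ^ 'n \<Rightarrow> real ^ 'p"
    and W \<Theta> :: "(real ^ 'p) set"
    and \<theta>s :: "real ^ 'p"
    and l \<alpha>1 \<alpha>2 q1 q2 :: "real \<Rightarrow> real"
    and r R rs Rs \<theta>lo \<theta>hi \<eta> L \<delta>b :: real
  assumes "0 < r" and "r < R"
    and f_lip: "\<And>u. u \<in> U \<Longrightarrow> locally_lipschitz (\<lambda>x. f x u)"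
    and f_cont: "continuous_on (UNIV \<times> U) (\<lambda>(x, u). f x u)"
    and clf: "control_lyapunov f U V w \<alpha>1 \<alpha>2"
    and \<phi>_lip: "locally_lipschitz \<phi>"
    and critic_nonneg: "\<And>x \<theta>. \<theta> \<in> W \<Longrightarrow> 0 \<le> critic \<phi> x \<theta>"
    and critic_upper: "\<And>X. compact X \<Longrightarrow> \<exists>LX. critic_constant \<phi> W X LX"
    and l_K: "class_K \<infinity> l"
    and critic_lower: "\<And>x \<theta>. \<theta> \<in> W \<Longrightarrow> l (norm x) * norm \<theta> \<le> critic \<phi> x \<theta>"
    and \<theta>s: "\<theta>s \<in> W" "\<And>x. V x = critic \<phi> x \<theta>s"
    and \<theta>_bounds: "\<theta>lo \<le> norm \<theta>s" "norm \<theta>s \<le> \<theta>hi"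
    and \<Theta>_eq: "\<Theta> = weight_set W \<theta>lo \<theta>hi"
    and q1_eq: "q1 = (\<lambda>s. l s * \<theta>lo)"
    and q2_eq: "q2 = (\<lambda>s. \<theta>hi * L * s)"
    and q_K_inf: "class_K_inf q1" "class_K_inf q2"
    and \<eta>: "0 < \<eta>"
    and Rs: "R < Rs" "critic_sup \<phi> R \<Theta> + \<eta> \<le> q1 Rs"
    and L: "0 < L" "critic_constant \<phi> W (cball 0 Rs) L"
    and rs_eq: "rs = inv_into {0..} q2 (q1 r / 2)"
    and \<delta>b: "sampling_bound f U V w rs Rs \<delta>b"
  shows "\<forall>K. compact K \<and> K \<subseteq> U \<longrightarrow>
    (\<exists>\<delta>0 \<epsilon>1b \<epsilon>3b.
       0 < \<delta>0 \<and> \<delta>0 \<le> \<delta>b \<and>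
       (\<forall>\<delta>. 0 < \<delta> \<and> \<delta> \<le> \<delta>0 \<longrightarrow> 0 < \<epsilon>1b \<delta> \<and> 0 < \<epsilon>3b \<delta>) \<and>
       practically_stabilizes R r \<delta>0
         (\<lambda>\<delta>. {x. \<exists>\<epsilon>1 \<epsilon>2 \<epsilon>3 \<theta>i u \<theta>.
            0 \<le> \<epsilon>1 \<and> \<epsilon>1 \<le> \<epsilon>1b \<delta> \<and> 0 \<le> \<epsilon>2 \<and> 0 \<le> \<epsilon>3 \<and> \<epsilon>3 \<le> \<epsilon>3b \<delta> \<and>
            sh_trajectory f U \<delta> u x \<and> range u \<subseteq> K \<and>
            ac_admissible f U \<phi> \<Theta> V w q1 q2 rs \<delta> \<epsilon>1 \<epsilon>2 \<epsilon>3 x \<theta>i u \<theta>}))"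
proof (intro allI impI)
  fix K :: "(real ^ 'm) set"
  assume "compact K \<and> K \<subseteq> U"
  then have K: "compact K" "K \<subseteq> U" by auto

  have "0 < R" "0 < Rs" using \<open>0 < r\<close> \<open>r < R\<close> Rs(1) by auto
  have q1r: "0 < q1 r"
    using strict_mono_onD[OF class_K_infD(2)[OF q_K_inf(1)], of 0 r] class_K_infD(3)[OF q_K_inf(1)]
      \<open>0 < r\<close> by simp
  have \<theta>s_norm: "0 < norm \<theta>s"
  proof -
    have "0 < V (axis undefined 1)"
      using clf by (simp add: control_lyapunov_def positive_definite_def axis_eq_0_iff)
    then show ?thesis using \<theta>s(2) by (auto simp: critic_def)
  qed
  then have \<theta>hi: "0 < \<theta>hi" using \<theta>_bounds by linarith
  then have hiL: "0 < \<theta>hi * L" using L(1) by simp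

  \<comment> \<open>the linear function \<open>q2\<close> is inverted by a division\<close>
  have q2rs: "q2 rs = q1 r / 2" and "0 \<le> rs"
  proof -
    have "q1 r / 2 \<in> q2 ` {0..}"
      using q1r hiL by (auto simp: q2_eq intro!: image_eqI[of _ _ "q1 r / 2 / (\<theta>hi * L)"])
    then show "q2 rs = q1 r / 2" "0 \<le> rs"
      using f_inv_into_f[of "q1 r / 2" q2 "{0..}"] inv_into_into[of "q1 r / 2" q2 "{0..}"]
      by (simp_all add: rs_eq)
  qed
  then have "0 < rs" using q1r by (cases "rs = 0") (auto simp: q2_eq)
  \<comment> \<open>both critic bounds hold for the weight \<open>\<theta>s\<close>, hence \<open>l r \<le> L r\<close>, so \<open>q1 r \<le> q2 r\<close>\<close>
  have "rs < r"
  proof -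
    let ?x = "r *\<^sub>R axis undefined 1 :: real ^ 'n"
    have x: "norm ?x = r" "?x \<in> cball 0 Rs"
      using \<open>0 < r\<close> \<open>r < R\<close> Rs(1) by (auto simp: norm_axis_1)
    have "critic \<phi> ?x \<theta>s \<le> norm \<theta>s * L * norm ?x"
      using L(2) \<theta>s(1) x(2) unfolding critic_constant_def by blast
    then have "norm \<theta>s * l r \<le> norm \<theta>s * (L * r)"
      using critic_lower[OF \<theta>s(1), of ?x] unfolding x(1) by (simp add: ac_simps)
    then have "l r \<le> L * r"
      using \<theta>s_norm by (simp only: mult_le_cancel_left_pos)
    moreover have "0 < \<theta>lo"
    proof -
      have "0 \<le> l r" using l_K \<open>0 < r\<close> by (simp add: class_K_def Let_def)
      then show ?thesis using q1r by (simp add: q1_eq zero_less_mult_iff)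
    qed
    ultimately have "l r * \<theta>lo \<le> L * r * \<theta>hi"
      using \<theta>_bounds L(1) \<open>0 < r\<close> by (intro mult_mono) auto
    then have "q1 r \<le> q2 r" by (simp add: q1_eq q2_eq ac_simps)
    then have "\<theta>hi * L * rs < \<theta>hi * L * r"
      using q2rs q1r by (simp add: q2_eq)
    then show ?thesis using hiL by (simp only: mult_less_cancel_left_pos)
  qed

  \<comment> \<open>\<open>R1\<close> bounds the samples; the gaps \<open>Rs - R1\<close> and \<open>r - r1\<close> absorb the motion between samples\<close>
  obtain R1 where R1: "R \<le> R1" "R1 < Rs" "q1 R1 = max (critic_sup \<phi> R \<Theta>) (q1 R)"
  proof (rule class_K_inf_radius[OF q_K_inf(1), of R Rs "max (critic_sup \<phi> R \<Theta>) (q1 R)"])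
    have "q1 R < q1 Rs"
      using strict_mono_onD[OF class_K_infD(2)[OF q_K_inf(1)], of R Rs] \<open>0 < R\<close> Rs(1) by simp
    then show "max (critic_sup \<phi> R \<Theta>) (q1 R) < q1 Rs" using Rs(2) \<eta> by simp
  qed (use \<open>0 < R\<close> Rs(1) in auto)
  obtain r1 where r1: "0 \<le> r1" "r1 < r" "q1 r1 = 3 / 4 * q1 r"
    using class_K_inf_radius[OF q_K_inf(1), of 0 r "3 / 4 * q1 r"] \<open>0 < r\<close> q1r
      class_K_infD(3)[OF q_K_inf(1)] by auto
  have r1R1: "q1 r1 \<le> q1 R1"
    using class_K_inf_le_iff[OF q_K_inf(1), of r1 R1] r1 R1(1) \<open>r < R\<close> \<open>0 < R\<close> by simp

  obtain c where c: "0 < c" "\<And>y. rs \<le> norm y \<Longrightarrow> norm y \<le> Rs \<Longrightarrow> 8 * c \<le> w y"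
  proof -
    let ?A = "cball 0 Rs - ball 0 rs :: (real ^ 'n) set"
    have A: "compact ?A" by (intro compact_diff) auto
    have w_clf: "continuous_on UNIV w" "positive_definite w"
      using clf by (simp_all add: control_lyapunov_def)
    have w: "continuous_on ?A w" "\<And>y. y \<in> ?A \<Longrightarrow> 0 < w y"
    proof -
      show "continuous_on ?A w" using w_clf(1) by (rule continuous_on_subset) simp
      show "0 < w y" if "y \<in> ?A" for y
        using that \<open>0 < rs\<close> w_clf(2) by (cases "y = 0") (auto simp: positive_definite_def)
    qed
    show thesis
    proof (cases "?A = {}")
      case True
      then show thesis by (intro that[of 1]) (auto simp: set_eq_iff not_less)
    next
      case False
      then obtain y where y: "y \<in> ?A" "\<And>z. z \<in> ?A \<Longrightarrow> w y \<le> w z"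
        using continuous_attains_inf[OF A _ w(1)] by blast
      have "8 * (w y / 8) \<le> w z" if "rs \<le> norm z" "norm z \<le> Rs" for z
        using y(2)[of z] that by simp
      then show thesis using w(2)[OF y(1)] by (intro that[of "w y / 8"]) auto
    qed
  qed

  \<comment> \<open>with this oscillation the prediction error costs at most \<open>c \<delta>\<close> in the critic\<close>
  define e where "e = c / (\<theta>hi * L)"
  have "0 < e" using c hiL by (simp add: e_def)
  have "continuous_on (cball 0 Rs \<times> K) (\<lambda>(x, u). f x u)"
    using K by (intro continuous_on_subset[OF f_cont]) auto
  then obtain M h where M: "0 < M" "\<And>x u. x \<in> cball 0 Rs \<Longrightarrow> u \<in> K \<Longrightarrow> norm (f x u) \<le> M"
    and h: "0 < h" "\<And>x y u. x \<in> cball 0 Rs \<Longrightarrow> y \<in> cball 0 Rs \<Longrightarrow> u \<in> K \<Longrightarrow> dist x y < h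
      \<Longrightarrow> norm (f y u - f x u) \<le> e"
    using compact_product_bound_and_modulus[OF compact_cball K(1) _ \<open>0 < e\<close>, of 0 Rs f] by metis

  \<comment> \<open>\<open>D\<close> bounds the motion during one sampling period\<close>
  define D where "D = min (min (Rs - R1) (h / 2))
    (min (r - r1) (min (r - rs) (q1 r / 4 / (\<theta>hi * L))))"
  have D: "0 < D" "D \<le> Rs - R1" "D < h" "D \<le> r - r1" "D \<le> r - rs" "\<theta>hi * L * D \<le> q1 r / 4"
  proof -
    show "0 < D"
      using R1 h r1 \<open>rs < r\<close> q1r hiL by (simp add: D_def)
    show "D \<le> Rs - R1" "D \<le> r - r1" "D \<le> r - rs" by (simp_all add: D_def)
    have "D \<le> h / 2" unfolding D_def by linarith
    then show "D < h" using h(1) by linarith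
    have "D \<le> q1 r / 4 / (\<theta>hi * L)" unfolding D_def by linarith
    then show "\<theta>hi * L * D \<le> q1 r / 4"
      using hiL by (simp add: pos_le_divide_eq mult.commute)
  qed
  define \<delta>0 where "\<delta>0 = min \<delta>b (D / (2 * M))"
  have \<delta>0: "0 < \<delta>0" "\<delta>0 \<le> \<delta>b" "\<And>\<delta>. \<delta> \<le> \<delta>0 \<Longrightarrow> M * \<delta> < D"
  proof -
    show "0 < \<delta>0" "\<delta>0 \<le> \<delta>b"
      using \<delta>b D(1) M(1) by (auto simp: \<delta>0_def sampling_bound_def)
    show "M * \<delta> < D" if "\<delta> \<le> \<delta>0" for \<delta>
    proof -
      have "\<delta> \<le> D / (2 * M)" using that by (simp add: \<delta>0_def)
      then have "M * \<delta> \<le> M * (D / (2 * M))" using M(1) by (intro mult_left_mono) auto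
      also have "\<dots> = D / 2" using M(1) by simp
      finally show ?thesis using D(1) by linarith
    qed
  qed
  define T where "T = q1 R1 / c + \<delta>b"

  have key: "norm (x t) \<le> Rs \<and> (T \<le> t \<longrightarrow> norm (x t) \<le> r)"
    if \<delta>: "0 < \<delta>" "\<delta> \<le> \<delta>0" and \<epsilon>: "\<epsilon>1 \<le> c * \<delta>" "\<epsilon>3 \<le> c * \<delta>"
      and traj: "sh_trajectory f U \<delta> u x" and uK: "range u \<subseteq> K"
      and adm: "ac_admissible f U \<phi> \<Theta> V w q1 q2 rs \<delta> \<epsilon>1 \<epsilon>2 \<epsilon>3 x \<theta>i u \<theta>"
      and x0: "x 0 \<in> cball 0 R" and t: "0 \<le> t"
    for \<delta> \<epsilon>1 \<epsilon>2 \<epsilon>3 :: real and \<theta>i u \<theta> x t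
  proof -
    define s where "s k = x (real k * \<delta>)" for k
    define core where "core k \<longleftrightarrow> norm (s k) \<le> rs" for k
    define J where "J k = critic \<phi> (s k) (\<theta> k)" for k
    have MD: "M * \<delta> < D" using \<delta>0(3) \<delta>(2) .
    have feas: "ac_feasible f U \<phi> \<Theta> V w q1 q2 \<delta> \<epsilon>1 \<epsilon>2 \<epsilon>3 (s k)
        (case k of 0 \<Rightarrow> \<theta>i | Suc j \<Rightarrow> \<theta> j) (u k) (\<theta> k)" if "\<not> core k" for k
      using adm that by (auto simp: ac_admissible_def core_def s_def)

    have near: "norm (x \<tau> - s k) \<le> D"
      and pred: "norm (s (Suc k) - predicted_state f \<delta> (u k) (s k)) \<le> e * \<delta>"
      if sk: "norm (s k) \<le> R1" and \<tau>: "\<tau> \<in> {real k * \<delta>..real (Suc k) * \<delta>}" for k \<tau>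
    proof -
      let ?a = "real k * \<delta>" and ?b = "real (Suc k) * \<delta>" and ?g = "\<lambda>y. f y (u k)"
      have ab: "?b - ?a = \<delta>" by (simp add: algebra_simps)
      have cont: "continuous_on {?a..?b} x"
        using traj \<delta>(1) unfolding sh_trajectory_def
        by (auto intro!: continuous_on_subset[of "{0..}" x] intro: order_trans[rotated])
      have der: "(x has_vector_derivative ?g (x t')) (at t' within {?a..<?b})"
        if "t' \<in> {?a..<?b}" for t'
        using traj that unfolding sh_trajectory_def by blast
      have sub: "y \<in> cball 0 Rs" if "y \<in> cball (x ?a) D" for y
        using that sk D(2) norm_triangle_ineq[of "s k" "y - s k"]
        by (simp add: s_def dist_norm norm_minus_commute)
      have x: "x ?a \<in> cball 0 Rs" using sub D(1) by simp
      have bnd: "norm (?g y) \<le> M" if "y \<in> cball (x ?a) D" for y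
        using M(2)[OF sub[OF that]] uK by blast
      have osc: "norm (?g y - ?g (x ?a)) \<le> e" if "y \<in> cball (x ?a) D" for y
        using that uK D(3) by (intro h(2)[OF x sub[OF that]]) auto
      have "norm (x \<tau> - x ?a) \<le> M * (\<tau> - ?a)"
        by (rule held_displacement[OF cont der bnd _ _ \<tau>]) (use MD M(1) ab in auto)
      also have "\<dots> \<le> M * \<delta>"
        using \<tau> ab M(1) by (intro mult_left_mono) auto
      finally show "norm (x \<tau> - s k) \<le> D" using MD by (simp add: s_def)
      have "norm (x ?b - (x ?a + (?b - ?a) *\<^sub>R ?g (x ?a))) \<le> e * (?b - ?a)"
        by (rule held_prediction_error[OF _ cont der bnd _ _ osc]) (use MD M(1) ab \<delta>(1) in auto)
      then show "norm (s (Suc k) - predicted_state f \<delta> (u k) (s k)) \<le> e * \<delta>"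
        unfolding ab by (simp add: s_def predicted_state_def)
    qed

    have next_sample: "real (Suc k) * \<delta> \<in> {real k * \<delta>..real (Suc k) * \<delta>}" for k
      using \<delta>(1) by (simp add: mult_right_mono)

    \<comment> \<open>the lower bound in (C4) translates levels of \<open>J\<close> into radii\<close>
    have radius: "norm (s k) \<le> \<rho>" if "\<not> core k" "J k \<le> q1 \<rho>" "0 \<le> \<rho>" for k \<rho>
      using feas[OF that(1)] that class_K_inf_le_iff[OF q_K_inf(1), of "norm (s k)" \<rho>]
      by (simp add: ac_feasible_def J_def)
    have nonneg: "0 \<le> J k" if "\<not> core k" for k
      using feas[OF that] critic_nonneg by (simp add: ac_feasible_def J_def \<Theta>_eq weight_set_def)

    have start: "J 0 \<le> q1 R1" if "\<not> core 0"
    proof -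
      have "J 0 \<le> critic_sup \<phi> R \<Theta>"
        unfolding J_def \<Theta>_eq
      proof (rule critic_le_critic_sup[OF L(2)])
        show "\<theta> 0 \<in> weight_set W \<theta>lo \<theta>hi"
          using feas[OF that] by (simp add: ac_feasible_def \<Theta>_eq)
      qed (use L(1) Rs(1) x0 in \<open>auto simp: s_def\<close>)
      then show ?thesis using R1(3) by simp
    qed

    have step: "J (Suc k) \<le> J k - c * \<delta>"
      if out: "\<not> core k" "\<not> core (Suc k)" and Jk: "J k \<le> q1 R1" for k
    proof -
      let ?p = "predicted_state f \<delta> (u k) (s k)"
      have sk: "norm (s k) \<le> R1" using radius[OF out(1) Jk] R1(1) \<open>0 < R\<close> by simp
      have s': "norm (s (Suc k)) \<le> Rs"
        using near[OF sk next_sample] D(2) sk norm_triangle_ineq[of "s k" "s (Suc k) - s k"]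
        by (simp add: s_def)
      have p: "norm ?p \<le> Rs"
      proof -
        have "norm (f (s k) (u k)) \<le> M"
          using sk R1(2) uK by (intro M(2)) auto
        then have "norm (\<delta> *\<^sub>R f (s k) (u k)) \<le> M * \<delta>"
          using \<delta>(1) by (simp add: mult.commute mult_left_mono)
        then show ?thesis
          using norm_triangle_ineq[of "s k" "\<delta> *\<^sub>R f (s k) (u k)"] MD D(2) sk
          by (simp add: predicted_state_def)
      qed
      have F: "\<theta> k \<in> \<Theta>" "critic \<phi> ?p (\<theta> k) - J k \<le> - (\<delta> / 2) * w (s k) + \<epsilon>3"
        using feas[OF out(1)] by (auto simp: ac_feasible_def J_def)
      have C1: "J (Suc k) \<le> critic \<phi> (s (Suc k)) (\<theta> k) + \<epsilon>1"
        using feas[OF out(2)] by (simp add: ac_feasible_def J_def)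
      have "critic \<phi> (s (Suc k)) (\<theta> k) - critic \<phi> ?p (\<theta> k) \<le> \<theta>hi * L * norm (s (Suc k) - ?p)"
        using F(1) p s' L by (intro critic_diff_le) (auto simp: \<Theta>_eq weight_set_def)
      also have "\<dots> \<le> \<theta>hi * L * (e * \<delta>)"
        using pred[OF sk next_sample] hiL by (intro mult_left_mono) auto
      also have "\<dots> = c * \<delta>" using \<theta>hi L(1) by (simp add: e_def)
      finally have "critic \<phi> (s (Suc k)) (\<theta> k) - critic \<phi> ?p (\<theta> k) \<le> c * \<delta>" .
      moreover have "4 * (c * \<delta>) \<le> \<delta> / 2 * w (s k)"
        using mult_left_mono[OF c(2)[of "s k"], of "\<delta> / 2"] out(1) sk R1(2) \<delta>(1)
        by (simp add: core_def algebra_simps)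
      ultimately show ?thesis using F(2) C1 \<epsilon> by linarith
    qed

    \<comment> \<open>on leaving the core ball only the upper bound in (C4) is available\<close>
    have restart: "J (Suc k) \<le> q1 r1" if "core k" "\<not> core (Suc k)" for k
    proof -
      have "norm (s k) \<le> R1" using that(1) \<open>rs < r\<close> \<open>r < R\<close> R1(1) by (simp add: core_def)
      from near[OF this next_sample] have "norm (s (Suc k)) \<le> rs + D"
        using norm_triangle_ineq[of "s k" "s (Suc k) - s k"] that(1)
        by (simp add: core_def s_def)
      then have "\<theta>hi * L * norm (s (Suc k)) \<le> \<theta>hi * L * (rs + D)"
        using hiL by (intro mult_left_mono) auto
      moreover have "J (Suc k) \<le> \<theta>hi * L * norm (s (Suc k))"
        using feas[OF that(2)] by (simp add: ac_feasible_def J_def q2_eq)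
      ultimately show ?thesis
        using D(6) q2rs r1(3) by (simp add: q2_eq distrib_left)
    qed

    have levels: "core k \<or> J k \<le> q1 r1 \<or> J k \<le> q1 R1 - real k * (c * \<delta>)" for k
      using c(1) \<delta>(1) r1R1 start step restart by (intro descent_with_restarts) auto

    obtain k where k: "t \<in> {real k * \<delta>..real (Suc k) * \<delta>}" "t < real (Suc k) * \<delta>"
      using sampling_interval[OF \<delta>(1) t] .
    have xt: "norm (x t) \<le> norm (s k) + D" if "norm (s k) \<le> R1"
      using near[OF that k(1)] norm_triangle_ineq[of "s k" "x t - s k"] by simp
    have "norm (s k) \<le> R1"
    proof (cases "core k")
      case True
      then show ?thesis using \<open>rs < r\<close> \<open>r < R\<close> R1(1) by (simp add: core_def)
    next
      case False
      have "0 \<le> real k * (c * \<delta>)" using c(1) \<delta>(1) by simp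
      then have "J k \<le> q1 R1" using levels[of k] False r1R1 by linarith
      then show ?thesis using radius[OF False] R1(1) \<open>0 < R\<close> by simp
    qed
    moreover have "norm (x t) \<le> r" if "T \<le> t"
    proof (cases "core k")
      case True
      then show ?thesis using xt[OF \<open>norm (s k) \<le> R1\<close>] D(5) by (simp add: core_def)
    next
      case False
      have "q1 R1 / c < real k * \<delta>"
        using that k(2) \<delta>(2) \<delta>0(2) by (simp add: T_def distrib_right)
      then have "q1 R1 < real k * (c * \<delta>)"
        using c(1) by (simp add: pos_divide_less_eq mult.commute mult.left_commute)
      then have "J k \<le> q1 r1" using levels[of k] nonneg[OF False] False by linarith
      then have "norm (s k) \<le> r1" using radius[OF False] r1(1) by simp
      then show ?thesis using xt[OF \<open>norm (s k) \<le> R1\<close>] D(4) by simp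
    qed
    ultimately show ?thesis using xt D(2) by force
  qed

  have "0 \<le> q1 R1"
    using r1R1 r1(3) q1r by linarith
  then have "0 \<le> T" using c(1) \<delta>0(1,2) by (simp add: T_def)
  show "\<exists>\<delta>0 \<epsilon>1b \<epsilon>3b.
       0 < \<delta>0 \<and> \<delta>0 \<le> \<delta>b \<and>
       (\<forall>\<delta>. 0 < \<delta> \<and> \<delta> \<le> \<delta>0 \<longrightarrow> 0 < \<epsilon>1b \<delta> \<and> 0 < \<epsilon>3b \<delta>) \<and>
       practically_stabilizes R r \<delta>0
         (\<lambda>\<delta>. {x. \<exists>\<epsilon>1 \<epsilon>2 \<epsilon>3 \<theta>i u \<theta>.
            0 \<le> \<epsilon>1 \<and> \<epsilon>1 \<le> \<epsilon>1b \<delta> \<and> 0 \<le> \<epsilon>2 \<and> 0 \<le> \<epsilon>3 \<and> \<epsilon>3 \<le> \<epsilon>3b \<delta> \<and>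
            sh_trajectory f U \<delta> u x \<and> range u \<subseteq> K \<and>
            ac_admissible f U \<phi> \<Theta> V w q1 q2 rs \<delta> \<epsilon>1 \<epsilon>2 \<epsilon>3 x \<theta>i u \<theta>})"
  proof (intro exI[of _ \<delta>0] exI[of _ "\<lambda>\<delta>. c * \<delta>"] conjI)
    show "practically_stabilizes R r \<delta>0
         (\<lambda>\<delta>. {x. \<exists>\<epsilon>1 \<epsilon>2 \<epsilon>3 \<theta>i u \<theta>.
            0 \<le> \<epsilon>1 \<and> \<epsilon>1 \<le> c * \<delta> \<and> 0 \<le> \<epsilon>2 \<and> 0 \<le> \<epsilon>3 \<and> \<epsilon>3 \<le> c * \<delta> \<and>
            sh_trajectory f U \<delta> u x \<and> range u \<subseteq> K \<and>
            ac_admissible f U \<phi> \<Theta> V w q1 q2 rs \<delta> \<epsilon>1 \<epsilon>2 \<epsilon>3 x \<theta>i u \<theta>})"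
      unfolding practically_stabilizes_def
    proof (intro exI[of _ T] conjI allI ballI impI)
      fix \<delta> x
      assume \<delta>: "0 < \<delta> \<and> \<delta> \<le> \<delta>0" and x0: "x 0 \<in> cball 0 R"
        and "x \<in> {x. \<exists>\<epsilon>1 \<epsilon>2 \<epsilon>3 \<theta>i u \<theta>.
            0 \<le> \<epsilon>1 \<and> \<epsilon>1 \<le> c * \<delta> \<and> 0 \<le> \<epsilon>2 \<and> 0 \<le> \<epsilon>3 \<and> \<epsilon>3 \<le> c * \<delta> \<and>
            sh_trajectory f U \<delta> u x \<and> range u \<subseteq> K \<and>
            ac_admissible f U \<phi> \<Theta> V w q1 q2 rs \<delta> \<epsilon>1 \<epsilon>2 \<epsilon>3 x \<theta>i u \<theta>}"
      then obtain \<epsilon>1 \<epsilon>2 \<epsilon>3 \<theta>i u \<theta> where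
        "\<epsilon>1 \<le> c * \<delta>" "\<epsilon>3 \<le> c * \<delta>" "sh_trajectory f U \<delta> u x" "range u \<subseteq> K"
        "ac_admissible f U \<phi> \<Theta> V w q1 q2 rs \<delta> \<epsilon>1 \<epsilon>2 \<epsilon>3 x \<theta>i u \<theta>"
        unfolding mem_Collect_eq by (elim exE conjE)
      from key[OF conjunct1[OF \<delta>] conjunct2[OF \<delta>] this x0]
      have b: "norm (x t) \<le> Rs \<and> (T \<le> t \<longrightarrow> norm (x t) \<le> r)" if "0 \<le> t" for t
        using that .
      then show "bounded (x ` {0..})" by (auto simp: bounded_iff)
      show "x t \<in> cball 0 r" if "T \<le> t" for t
        using b[of t] that \<open>0 \<le> T\<close> by simp
    qed (fact \<open>0 \<le> T\<close>)
  qed (use \<delta>0 c(1) in auto)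
qed

end
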